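(* Let $m>0$ be a real number and let $f(x)=x^m$ for all real $x>0$. Let $S=\{x_1,x_2,\dots,x_n\}$ be a set of $n$ distinct positive integers. (a) For any such set $S$, $i_{+}((S^{\ast\ast})_f)=n$ and $i_{-}((S^{\ast\ast})_f)=i_{0}((S^{\ast\ast})_f)=0$. (b) If $S$ is UD-closed, then $i_{+}([S^{\ast\ast}]_f)$ is the number of $x_i\in S$ such that $\omega(x_i)$ is even, $i_{-}([S^{\ast\ast}]_f)$ is the number of $x_i\in S$ such that $\omega(x_i)$ is odd, and $i_{0}([S^{\ast\ast}]_f)=0$.
   Context: A positive divisor $d$ of a positive integer $n$ is a unitary divisor of $n$, written $d\parallel n$, if $\gcd(d,n/d)=1$. For positive integers $a,b$, $(a,b)^{\ast\ast}$ denotes the greatest common unitary divisor of $a$ and $b$ (the largest $d$ with $d\parallel a$ and $d\parallel b$), and $[a,b]^{\ast\ast}=ab/(a,b)^{\ast\ast}$ is the pseudo-LCUM (pseudo least common unitary multiple). For a set $S=\{x_1,\dots,x_n\}$ of distinct positive integers, $(S^{\ast\ast})_f$ is the $n\times n$ matrix with $ij$ entry $f((x_i,x_j)^{\ast\ast})$, and $[S^{\ast\ast}]_f$ is the $n\times n$ matrix with $ij$ entry $f([x_i,x_j]^{\ast\ast})$. $S$ is UD-closed (unitary divisor closed) if every unitary divisor of every element of $S$ belongs to $S$. For a Hermitian matrix $H$, $i_{+}(H)$, $i_{-}(H)$, $i_0(H)$ denote the numbers of positive, negative and zero eigenvalues of $H$, respectively, counted with multiplicity. $\omega(x)$ is the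 number of distinct prime factors of $x$, with $\omega(1)=0$. *)

theory Defs
  imports
    "HOL-Analysis.Analysis"
    "HOL-Computational_Algebra.Primes"
    "Jordan_Normal_Form.Char_Poly"
begin

definition unitary_divisor :: "nat \<Rightarrow> nat \<Rightarrow> bool" (infix "udvd" 50) where
  "d udvd n \<longleftrightarrow> d dvd n \<and> coprime d (n div d)"

definition gcud :: "nat \<Rightarrow> nat \<Rightarrow> nat" where
  "gcud a b = Max {d. d udvd a \<and> d udvd b}"

text \<open>The division is exact, since \<open>gcud a b\<close> divides \<open>a\<close>.\<close>
definition pseudo_lcum :: "nat \<Rightarrow> nat \<Rightarrow> nat" where
  "pseudo_lcum a b = a * b div gcud a b"

definition UD_closed :: "nat set \<Rightarrow> bool" where
  "UD_closed S \<longleftrightarrow> (\<forall>s\<in>S. \<forall>d. d udvd s \<longrightarrow> d \<in> S)"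

definition omega :: "nat \<Rightarrow> nat" where
  "omega n = card (prime_factors n)"

text \<open>The set \<open>S\<close> is given by an enumeration \<open>x 0, \<dots>, x (n - 1)\<close>, matching the
  0-based indexing of matrices. Entries are embedded in the complex numbers because
  inertia is defined for Hermitian matrices.\<close>

definition gcud_matrix :: "(real \<Rightarrow> real) \<Rightarrow> nat \<Rightarrow> (nat \<Rightarrow> nat) \<Rightarrow> complex mat" where
  "gcud_matrix f n x = Matrix.mat n n (\<lambda>(i, j). complex_of_real (f (real (gcud (x i) (x j)))))"

definition pseudo_lcum_matrix :: "(real \<Rightarrow> real) \<Rightarrow> nat \<Rightarrow> (nat \<Rightarrow> nat) \<Rightarrow> complex mat" where
  "pseudo_lcum_matrix f n x =
     Matrix.mat n n (\<lambda>(i, j). complex_of_real (f (real (pseudo_lcum (x i) (x j)))))"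

text \<open>The inertia of a Hermitian matrix. Its eigenvalues are real, so the reality conditions
  only serve to make the sign of a complex number meaningful; the multiplicity of an eigenvalue
  is its multiplicity as a root of the characteristic polynomial.\<close>

definition i_plus :: "complex mat \<Rightarrow> nat" where
  "i_plus H = (\<Sum>e | eigenvalue H e \<and> e \<in> \<real> \<and> Re e > 0. order e (char_poly H))"

definition i_minus :: "complex mat \<Rightarrow> nat" where
  "i_minus H = (\<Sum>e | eigenvalue H e \<and> e \<in> \<real> \<and> Re e < 0. order e (char_poly H))"

definition i_zero :: "complex mat \<Rightarrow> nat" where
  "i_zero H = (\<Sum>e | eigenvalue H e \<and> e = 0. order e (char_poly H))"

end

theory Submission
  imports Defs "Jordan_Normal_Form.Schur_Decomposition"
begin

text \<open>
  The Hermitian form of each matrix is a sum of squares of linear forms with weights whose signs are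
  visible, and these signs determine the inertia.

  Every power function is a sum over unitary divisors, \<open>n powr s = (\<Sum>d | d udvd n. J d)\<close>, where
  \<open>J d\<close> is the product of the numbers \<open>q powr s - 1\<close> over the prime-power components \<open>q\<close> of \<open>d\<close>
  (\<open>powr_eq_sum_unitary_jordan\<close>). Since the common unitary divisors of \<open>a\<close> and \<open>b\<close> are exactly the
  unitary divisors of \<open>gcud a b\<close> (\<open>common_unitary_divisors_eq\<close>), the Hermitian form of the matrix
  with entries \<open>w i * w j * gcud (x i) (x j) powr s\<close> is the sum over \<open>d\<close> of \<open>J d\<close> times the squared
  modulus of the linear form that adds up \<open>w i * v i\<close> over the indices \<open>i\<close> with \<open>d udvd x i\<close>. Here
  \<open>d\<close> ranges over the unitary divisors of the elements of \<open>S\<close>, and jointly these linear forms are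
  injective (\<open>unitary_incidence_injective\<close>).

  For part (a) take \<open>s = m\<close> and \<open>w i = 1\<close>: all the weights \<open>J d\<close> are positive, so the form is
  positive definite. For part (b) write \<open>pseudo_lcum a b powr m\<close> as
  \<open>a powr m * b powr m * gcud a b powr (- m)\<close> and take \<open>s = - m\<close> and \<open>w i = x i powr m\<close>. Now \<open>J d\<close>
  has the sign \<open>(-1) ^ omega d\<close>, and as \<open>S\<close> is UD-closed the index \<open>d\<close> runs over \<open>S\<close> itself, so there
  are just as many squares as variables.

  The passage from such a sum of squares to the multiplicities of eigenvalues is Sylvester's law of
  inertia (\<open>inertia_of_signed_sum_of_squares\<close>). It is proved by comparing dimensions, using an
  orthonormal basis of eigenvectors (\<open>hermitian_orthonormal_eigenvectors\<close>).
\<close>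

section \<open>An orthonormal eigenbasis of a Hermitian matrix\<close>

text \<open>Gaussian elimination by induction on the equations: if some coefficient of the new
  equation is nonzero, that equation expresses one unknown by the others and is used to eliminate
  it from the rest.\<close>
lemma underdetermined_system_nontrivial_solution:
  fixes a :: "'d \<Rightarrow> 'k \<Rightarrow> 'f::field"
  assumes "finite E" "finite K" "card E < card K"
  shows "\<exists>c. (\<exists>k\<in>K. c k \<noteq> 0) \<and> (\<forall>d\<in>E. (\<Sum>k\<in>K. a d k * c k) = 0)"
  using assms
proof (induction E arbitrary: K a rule: finite_induct)
  case empty
  then obtain k where "k \<in> K" by fastforce
  then show ?case by (intro exI[of _ "\<lambda>_. 1"]) auto
next
  case (insert d E)
  show ?case
  proof (cases "\<forall>k\<in>K. a d k = 0")
    case True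
    have "card E < card K" using insert by simp
    from insert.IH[OF insert.prems(1) this, of a] True show ?thesis by auto
  next
    case False
    then obtain p where p: "p \<in> K" "a d p \<noteq> 0" by auto
    \<comment> \<open>The equation \<open>e\<close> after elimination of the unknown \<open>p\<close> by means of the equation \<open>d\<close>.\<close>
    define b where "b = (\<lambda>e k. a e k - a e p * a d k / a d p)"
    have fin: "finite (K - {p})" using insert.prems by simp
    have "card E < card (K - {p})" using insert.prems insert.hyps p by simp
    from insert.IH[OF fin this, of b] obtain c where
      c: "\<exists>k\<in>K-{p}. c k \<noteq> 0" "\<And>e. e \<in> E \<Longrightarrow> (\<Sum>k\<in>K-{p}. b e k * c k) = 0" by auto
    define c' where "c' = c(p := - (\<Sum>k\<in>K-{p}. a d k * c k) / a d p)"
    have split: "(\<Sum>k\<in>K. a e k * c' k)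
      = (\<Sum>k\<in>K-{p}. a e k * c k) - a e p * (\<Sum>k\<in>K-{p}. a d k * c k) / a d p" for e
    proof -
      have "(\<Sum>k\<in>K. a e k * c' k) = a e p * c' p + (\<Sum>k\<in>K-{p}. a e k * c' k)"
        using insert.prems(1) p(1) by (rule sum.remove)
      also have "(\<Sum>k\<in>K-{p}. a e k * c' k) = (\<Sum>k\<in>K-{p}. a e k * c k)"
        by (rule sum.cong) (auto simp: c'_def)
      finally show ?thesis by (simp add: c'_def)
    qed
    have "(\<Sum>k\<in>K. a e k * c' k) = 0" if e: "e \<in> E" for e
    proof -
      have "(\<Sum>k\<in>K-{p}. b e k * c k)
        = (\<Sum>k\<in>K-{p}. a e k * c k) - a e p * (\<Sum>k\<in>K-{p}. a d k * c k) / a d p"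
        by (simp add: b_def algebra_simps sum_subtractf sum_distrib_left sum_divide_distrib)
      with c(2)[OF e] split[of e] show ?thesis by simp
    qed
    moreover have "(\<Sum>k\<in>K. a d k * c' k) = 0" using split[of d] p(2) by simp
    moreover have "\<exists>k\<in>K. c' k \<noteq> 0" using c(1) by (auto simp: c'_def)
    ultimately show ?thesis by blast
  qed
qed

text \<open>In the coordinates of a Schur decomposition \<open>A = P * B * Q\<close> with \<open>B\<close> upper triangular, take a
  nonzero \<open>w \<in> W\<close> whose coordinate vector \<open>Q *\<^sub>v w\<close> has its last nonzero entry, at index \<open>j\<close>, as
  early as possible. Subtracting \<open>B $$ (j, j)\<close> times the identity from \<open>A\<close> kills that entry, so
  \<open>A *\<^sub>v w - B $$ (j, j) \<cdot>\<^sub>v w\<close> would be an earlier choice unless it vanishes. The point of the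
  lemma is that the eigenvector can be found inside \<open>W\<close>, for instance inside an orthogonal
  complement.\<close>
lemma eigenvector_in_invariant_subset:
  fixes A :: "complex mat"
  assumes A: "A \<in> carrier_mat n n" and W: "W \<subseteq> carrier_vec n"
    and inv: "\<And>w z. w \<in> W \<Longrightarrow> A *\<^sub>v w - z \<cdot>\<^sub>v w \<in> W"
    and w0: "w0 \<in> W" "w0 \<noteq> 0\<^sub>v n"
  shows "\<exists>w\<in>W. w \<noteq> 0\<^sub>v n \<and> (\<exists>z. A *\<^sub>v w = z \<cdot>\<^sub>v w)"
proof -
  obtain es where es: "char_poly A = (\<Prod>a\<leftarrow>es. [:- a, 1:])"
    using char_poly_factorized[OF A] by blast
  obtain B P Q where BPQ: "schur_decomposition A es = (B, P, Q)" using prod_cases3 by blast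
  from schur_decomposition[OF A es this]
  have wit: "similar_mat_wit A B P Q" and tri: "upper_triangular B" by auto
  note wd = similar_mat_witD2[OF A wit]
  have B: "B \<in> carrier_mat n n" and P: "P \<in> carrier_mat n n" and Q: "Q \<in> carrier_mat n n"
    and PQ: "P * Q = 1\<^sub>m n" and QP: "Q * P = 1\<^sub>m n" and APBQ: "A = P * B * Q"
    using wd by auto
  \<comment> \<open>\<open>supp k w\<close>: in the coordinates given by \<open>Q\<close>, \<open>w\<close> lives on the indices below \<open>k\<close>.\<close>
  define supp where "supp = (\<lambda>k w. \<forall>j<n. k \<le> j \<longrightarrow> vec_index (Q *\<^sub>v w) j = 0)"
  define good where "good = (\<lambda>k. \<exists>w\<in>W. w \<noteq> 0\<^sub>v n \<and> supp k w)"
  have "good n" using w0 by (auto simp: good_def supp_def)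
  define k where "k = (LEAST k. good k)"
  have gk: "good k" unfolding k_def using \<open>good n\<close> by (rule LeastI)
  have least: "\<not> good j" if "j < k" for j using that not_less_Least unfolding k_def by blast
  from gk obtain w where w: "w \<in> W" "w \<noteq> 0\<^sub>v n" "supp k w" by (auto simp: good_def)
  have wc: "w \<in> carrier_vec n" using w W by auto
  have "k \<noteq> 0"
  proof
    assume "k = 0"
    then have "Q *\<^sub>v w = 0\<^sub>v n" using w(3) Q wc by (intro eq_vecI) (auto simp: supp_def)
    then have "P *\<^sub>v (Q *\<^sub>v w) = 0\<^sub>v n"
      using P by (intro eq_vecI) (auto simp: scalar_prod_def)
    moreover have "P *\<^sub>v (Q *\<^sub>v w) = w"
      using assoc_mult_mat_vec[OF P Q wc] PQ wc by simp
    ultimately show False using w(2) by simp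
  qed
  then obtain j where kj: "k = Suc j" by (cases k) auto
  have jn: "j < n"
  proof (rule ccontr)
    assume "\<not> j < n"
    then have "supp j w" by (auto simp: supp_def)
    then have "good j" using w by (auto simp: good_def)
    then show False using least kj by simp
  qed
  let ?b = "B $$ (j, j)"
  let ?y = "Q *\<^sub>v w"
  define w' where "w' = A *\<^sub>v w - ?b \<cdot>\<^sub>v w"
  have w'W: "w' \<in> W" unfolding w'_def using w(1) by (rule inv)
  have y: "?y \<in> carrier_vec n" using Q wc by simp
  have QA: "Q *\<^sub>v (A *\<^sub>v w) = B *\<^sub>v ?y"
  proof -
    have "A *\<^sub>v w = (P * B) *\<^sub>v ?y"
      unfolding APBQ using assoc_mult_mat_vec[of "P * B" n n Q n w] P B Q wc by simp
    also have "\<dots> = P *\<^sub>v (B *\<^sub>v ?y)" using P B y by (rule assoc_mult_mat_vec)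
    finally have "Q *\<^sub>v (A *\<^sub>v w) = (Q * P) *\<^sub>v (B *\<^sub>v ?y)"
      using assoc_mult_mat_vec[OF Q P, of "B *\<^sub>v ?y"] B y by simp
    then show ?thesis using QP B y by simp
  qed
  have Qw': "Q *\<^sub>v w' = B *\<^sub>v ?y - ?b \<cdot>\<^sub>v ?y"
    unfolding w'_def
    using mult_minus_distrib_mat_vec[OF Q, of "A *\<^sub>v w" "?b \<cdot>\<^sub>v w"] A wc QA
      mult_mat_vec[OF Q wc, of ?b] by simp
  have "supp j w'"
    unfolding supp_def
  proof (intro allI impI)
    fix i assume i: "i < n" "j \<le> i"
    have y0: "vec_index ?y l = 0" if "l < n" "j < l" for l
      using w(3) that kj by (auto simp: supp_def)
    have t0: "B $$ (i, l) = 0" if "l < i" for l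
      using upper_triangularD[OF tri that] i B by simp
    have "vec_index (B *\<^sub>v ?y) i = (\<Sum>l<n. B $$ (i, l) * vec_index ?y l)"
      using i B y Q by (simp add: scalar_prod_def atLeast0LessThan)
    also have "\<dots> = (\<Sum>l<n. if l = j then B $$ (i, j) * vec_index ?y j else 0)"
    proof (rule sum.cong)
      fix l assume "l \<in> {..<n}"
      then show "B $$ (i, l) * vec_index ?y l
          = (if l = j then B $$ (i, j) * vec_index ?y j else 0)"
        using y0[of l] t0[of l] i(2) by (cases "l = j"; cases "l < i") auto
    qed simp
    also have "\<dots> = B $$ (i, j) * vec_index ?y j" using jn by simp
    also have "\<dots> = ?b * vec_index ?y i"
      using t0[of j] y0[of i] i by (cases "i = j") auto
    finally show "vec_index (Q *\<^sub>v w') i = 0"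
      unfolding Qw' using i B Q y by simp
  qed
  then have "w' = 0\<^sub>v n" using least[of j] kj w'W by (auto simp: good_def)
  then have "A *\<^sub>v w - ?b \<cdot>\<^sub>v w + ?b \<cdot>\<^sub>v w = 0\<^sub>v n + ?b \<cdot>\<^sub>v w" by (simp add: w'_def)
  moreover have "A *\<^sub>v w - ?b \<cdot>\<^sub>v w + ?b \<cdot>\<^sub>v w = A *\<^sub>v w" using A wc by (intro eq_vecI) auto
  ultimately have "A *\<^sub>v w = ?b \<cdot>\<^sub>v w" using wc by simp
  then show ?thesis using w by blast
qed

lemma hermitian_sum_adjoint:
  fixes h :: "nat \<Rightarrow> nat \<Rightarrow> complex"
  assumes "\<And>i j. i < n \<Longrightarrow> j < n \<Longrightarrow> h j i = cnj (h i j)"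
  shows "(\<Sum>i<n. (\<Sum>j<n. h i j * v j) * cnj (w i)) = (\<Sum>j<n. v j * cnj (\<Sum>i<n. h j i * w i))"
proof -
  have "(\<Sum>i<n. (\<Sum>j<n. h i j * v j) * cnj (w i)) = (\<Sum>i<n. \<Sum>j<n. h i j * v j * cnj (w i))"
    by (simp add: sum_distrib_right)
  also have "\<dots> = (\<Sum>j<n. \<Sum>i<n. h i j * v j * cnj (w i))" by (rule sum.swap)
  also have "\<dots> = (\<Sum>j<n. \<Sum>i<n. v j * cnj (h j i * w i))"
  proof (intro sum.cong refl)
    fix i j assume "i \<in> {..<n}" "j \<in> {..<n}"
    then show "h i j * v j * cnj (w i) = v j * cnj (h j i * w i)"
      using assms[of i j] by simp
  qed
  finally show ?thesis by (simp add: sum_distrib_left)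
qed

text \<open>The spectral theorem, one eigenvector at a time. While \<open>k < n\<close>, the orthogonal complement of
  the eigenvectors found so far is nonzero (it is the solution space of \<open>k\<close> equations in \<open>n\<close>
  unknowns) and invariant (because \<open>h\<close> is self-adjoint), so it contains another eigenvector.\<close>
lemma hermitian_orthonormal_eigenvectors:
  fixes h :: "nat \<Rightarrow> nat \<Rightarrow> complex"
  assumes herm: "\<And>i j. i < n \<Longrightarrow> j < n \<Longrightarrow> h j i = cnj (h i j)" and "k \<le> n"
  shows "\<exists>(u :: nat \<Rightarrow> nat \<Rightarrow> complex) (e :: nat \<Rightarrow> real).
    (\<forall>a<k. \<forall>i<n. (\<Sum>j<n. h i j * u a j) = of_real (e a) * u a i) \<and>
    (\<forall>a<k. \<forall>b<k. (\<Sum>i<n. u a i * cnj (u b i)) = (if a = b then 1 else 0))"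
  using \<open>k \<le> n\<close>
proof (induction k)
  case 0
  then show ?case by auto
next
  case (Suc k)
  then have "k \<le> n" by simp
  from Suc.IH[OF this] obtain u :: "nat \<Rightarrow> nat \<Rightarrow> complex" and e :: "nat \<Rightarrow> real" where
    eig: "\<And>a i. a < k \<Longrightarrow> i < n \<Longrightarrow> (\<Sum>j<n. h i j * u a j) = of_real (e a) * u a i"
    and orth: "\<And>a b. a < k \<Longrightarrow> b < k \<Longrightarrow>
      (\<Sum>i<n. u a i * cnj (u b i)) = (if a = b then 1 else 0)"
    by blast
  define A where "A = Matrix.mat n n (\<lambda>(i, j). h i j)"
  have A: "A \<in> carrier_mat n n" by (simp add: A_def)
  have Av: "vec_index (A *\<^sub>v v) i = (\<Sum>j<n. h i j * vec_index v j)"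
    if "i < n" "v \<in> carrier_vec n" for v i
    using that by (simp add: A_def scalar_prod_def atLeast0LessThan)
  define W where "W = {w \<in> carrier_vec n. \<forall>b<k. (\<Sum>i<n. vec_index w i * cnj (u b i)) = 0}"
  have inv: "A *\<^sub>v w - z \<cdot>\<^sub>v w \<in> W" if w: "w \<in> W" for w z
  proof -
    have wc: "w \<in> carrier_vec n"
      and w0: "\<And>b. b < k \<Longrightarrow> (\<Sum>i<n. vec_index w i * cnj (u b i)) = 0"
      using w by (auto simp: W_def)
    have "(\<Sum>i<n. vec_index (A *\<^sub>v w - z \<cdot>\<^sub>v w) i * cnj (u b i)) = 0" if b: "b < k" for b
    proof -
      have "(\<Sum>i<n. vec_index (A *\<^sub>v w - z \<cdot>\<^sub>v w) i * cnj (u b i))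
        = (\<Sum>i<n. (\<Sum>j<n. h i j * vec_index w j) * cnj (u b i) - z * (vec_index w i * cnj (u b i)))"
        using wc A by (intro sum.cong refl) (auto simp: Av algebra_simps simp del: index_mult_mat_vec)
      also have "\<dots> = (\<Sum>i<n. (\<Sum>j<n. h i j * vec_index w j) * cnj (u b i))"
        by (simp add: sum_subtractf w0[OF b] flip: sum_distrib_left)
      also have "\<dots> = (\<Sum>j<n. vec_index w j * cnj (\<Sum>i<n. h j i * u b i))"
        using herm by (rule hermitian_sum_adjoint)
      also have "\<dots> = (\<Sum>j<n. of_real (e b) * (vec_index w j * cnj (u b j)))"
        by (intro sum.cong refl) (simp add: eig[OF b] mult_ac del: cnj_sum)
      also have "\<dots> = 0" by (simp add: w0[OF b] flip: sum_distrib_left)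
      finally show ?thesis .
    qed
    then show ?thesis using wc A by (simp add: W_def)
  qed
  have "card {..<k} < card {..<n}" using Suc.prems by simp
  from underdetermined_system_nontrivial_solution[OF _ _ this, of "\<lambda>b i. cnj (u b i)"]
  obtain c where c: "\<exists>i<n. c i \<noteq> 0" "\<And>b. b < k \<Longrightarrow> (\<Sum>i<n. cnj (u b i) * c i) = 0" by auto
  have "Matrix.vec n c \<in> W" using c(2) by (auto simp: W_def mult.commute)
  moreover have "Matrix.vec n c \<noteq> 0\<^sub>v n"
    using c(1) by (metis index_vec index_zero_vec(1))
  moreover have "W \<subseteq> carrier_vec n" by (auto simp: W_def)
  ultimately obtain w z where w: "w \<in> W" "w \<noteq> 0\<^sub>v n" and wz: "A *\<^sub>v w = z \<cdot>\<^sub>v w"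
    using eigenvector_in_invariant_subset[OF A _ inv] by blast
  define v where "v = vec_index w"
  have wc: "w \<in> carrier_vec n" using w by (simp add: W_def)
  have v0: "(\<Sum>i<n. v i * cnj (u b i)) = 0" if "b < k" for b
    using w(1) that by (simp add: W_def v_def)
  have hv: "(\<Sum>j<n. h i j * v j) = z * v i" if "i < n" for i
    using arg_cong[OF wz, of "\<lambda>x. vec_index x i"] Av[OF that wc] wc that
    by (simp add: v_def del: index_mult_mat_vec)
  define r where "r = (\<Sum>i<n. (cmod (v i))\<^sup>2)"
  have r: "(\<Sum>i<n. v i * cnj (v i)) = of_real r"
    unfolding r_def of_real_sum complex_norm_square ..
  obtain i0 where i0: "i0 < n" "v i0 \<noteq> 0"
    using w(2) wc unfolding v_def by (metis carrier_vecD eq_vecI index_zero_vec)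
  have r0: "r > 0"
    unfolding r_def by (rule sum_pos2[of _ i0]) (use i0 in auto)
  \<comment> \<open>Self-adjointness makes the eigenvalue real.\<close>
  have "z * of_real r = (\<Sum>i<n. (\<Sum>j<n. h i j * v j) * cnj (v i))"
    unfolding r[symmetric] sum_distrib_left by (intro sum.cong refl) (simp add: hv)
  also have "\<dots> = (\<Sum>j<n. v j * cnj (\<Sum>i<n. h j i * v i))"
    using herm by (rule hermitian_sum_adjoint)
  also have "\<dots> = cnj z * of_real r"
    unfolding r[symmetric] sum_distrib_left
    by (intro sum.cong refl) (subst hv, simp, simp add: mult_ac)
  finally have "cnj z = z" using r0 by simp
  then have z: "of_real (Re z) = z" by (simp add: complex_eq_iff)
  define u' where "u' = u(k := \<lambda>i. v i / of_real (sqrt r))"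
  define e' where "e' = e(k := Re z)"
  have sr: "complex_of_real (sqrt r) * of_real (sqrt r) = of_real r"
    using r0 by (simp flip: of_real_mult)
  have self: "(\<Sum>i<n. u' k i * cnj (u' k i)) = 1"
    using r0 r by (simp add: u'_def sr flip: sum_divide_distrib)
  have right: "(\<Sum>i<n. u' k i * cnj (u' b i)) = 0" if "b < k" for b
    using that v0[OF that] by (simp add: u'_def flip: sum_divide_distrib)
  have left: "(\<Sum>i<n. u' b i * cnj (u' k i)) = 0" if "b < k" for b
  proof -
    have "(\<Sum>i<n. u' b i * cnj (u' k i)) = cnj (\<Sum>i<n. u' k i * cnj (u' b i))"
      by (simp add: mult.commute)
    then show ?thesis using right[OF that] by simp
  qed
  have "(\<Sum>j<n. h i j * u' a j) = of_real (e' a) * u' a i" if "a < Suc k" "i < n" for a i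
    using that hv[of i] eig[of a i] z
    by (cases "a = k") (auto simp: u'_def e'_def simp flip: sum_divide_distrib)
  moreover have "(\<Sum>i<n. u' a i * cnj (u' b i)) = (if a = b then 1 else 0)"
    if "a < Suc k" "b < Suc k" for a b
  proof (cases "a < k \<and> b < k")
    case True
    then show ?thesis using orth[of a b] by (simp add: u'_def)
  next
    case False
    then show ?thesis using that self left right by (auto simp: less_Suc_eq)
  qed
  ultimately show ?case by (intro exI[of _ u'] exI[of _ e'] conjI allI impI)
qed

section \<open>Multiplicities of eigenvalues as a count\<close>

lemma order_prod_linear_factors:
  fixes c :: "'k \<Rightarrow> 'f::field"
  assumes "finite K"
  shows "Polynomial.order z (\<Prod>k\<in>K. [:- c k, 1:]) = card {k \<in> K. c k = z}"
  using assms
proof (induction K rule: finite_induct)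
  case empty
  then show ?case by simp
next
  case (insert k K)
  have "(\<Prod>k\<in>insert k K. [:- c k, 1:]) \<noteq> 0"
    by (subst prod_zero_iff) (use insert.hyps in auto)
  then have "Polynomial.order z (\<Prod>k\<in>insert k K. [:- c k, 1:])
      = Polynomial.order z [:- c k, 1:] + Polynomial.order z (\<Prod>k\<in>K. [:- c k, 1:])"
    unfolding prod.insert[OF insert.hyps] by (rule order_mult)
  moreover have "{j \<in> insert k K. c j = z} = (if c k = z then insert k else id) {j \<in> K. c j = z}"
    by auto
  ultimately show ?case using insert by (auto simp: order_linear')
qed

text \<open>The matrix of an orthonormal eigenbasis diagonalises \<open>h\<close>, so the algebraic multiplicities of
  the eigenvalues can be read off from the list \<open>e\<close>.\<close>
lemma char_poly_of_orthonormal_eigenbasis: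
  fixes h :: "nat \<Rightarrow> nat \<Rightarrow> complex"
  assumes eig: "\<And>a i. a < n \<Longrightarrow> i < n \<Longrightarrow> (\<Sum>j<n. h i j * u a j) = of_real (e a) * u a i"
    and orth: "\<And>a b. a < n \<Longrightarrow> b < n \<Longrightarrow>
      (\<Sum>i<n. u a i * cnj (u b i)) = (if a = b then 1 else 0)"
  shows "char_poly (Matrix.mat n n (\<lambda>(i, j). h i j)) = (\<Prod>a<n. [:- of_real (e a), 1:])"
proof -
  define H where "H = Matrix.mat n n (\<lambda>(i, j). h i j)"
  define E where "E = Matrix.mat n n (\<lambda>(a, b). if a = b then complex_of_real (e a) else 0)"
  define U where "U = Matrix.mat n n (\<lambda>(i, a). u a i)"
  define V where "V = Matrix.mat n n (\<lambda>(a, i). cnj (u a i))"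
  note defs = H_def E_def U_def V_def
  have H: "H \<in> carrier_mat n n" and E: "E \<in> carrier_mat n n"
    and U: "U \<in> carrier_mat n n" and V: "V \<in> carrier_mat n n"
    by (simp_all add: defs)
  have VU: "V * U = 1\<^sub>m n"
    unfolding defs
    by (rule eq_matI) (auto simp: scalar_prod_def atLeast0LessThan orth mult.commute)
  have UV: "U * V = 1\<^sub>m n" using V U VU by (rule mat_mult_left_right_inverse)
  have HU: "H * U = U * E"
  proof (rule eq_matI)
    fix i a assume "i < dim_row (U * E)" "a < dim_col (U * E)"
    then have *: "i < n" "a < n" using U E by auto
    have "(U * E) $$ (i, a) = (\<Sum>j<n. u j i * (if j = a then complex_of_real (e j) else 0))"
      using * by (simp add: defs scalar_prod_def atLeast0LessThan)
    also have "\<dots> = u a i * of_real (e a)" using *(2) by (simp add: if_distrib cong: if_cong)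
    finally show "(H * U) $$ (i, a) = (U * E) $$ (i, a)"
      using * by (simp add: defs scalar_prod_def atLeast0LessThan eig mult.commute)
  qed (use H U E in auto)
  have "H = H * (U * V)" unfolding UV using H by simp
  also have "\<dots> = U * E * V"
    unfolding HU[symmetric] using H U V by (rule assoc_mult_mat[symmetric])
  finally have "similar_mat_wit H E U V"
    unfolding similar_mat_wit_def Let_def using UV VU H E U V by auto
  then have "char_poly H = char_poly E"
    using char_poly_similar unfolding similar_mat_def by blast
  also have "\<dots> = (\<Prod>x\<leftarrow>diag_mat E. [:- x, 1:])"
    using E by (rule char_poly_upper_triangular) (auto simp: E_def)
  also have "\<dots> = (\<Prod>a\<leftarrow>[0..<n]. [:- of_real (e a), 1:])"
    by (rule arg_cong[of _ _ prod_list]) (auto simp: E_def diag_mat_def)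
  also have "\<dots> = (\<Prod>a<n. [:- of_real (e a), 1:])"
    by (simp add: prod.distinct_set_conv_list[symmetric] atLeast0LessThan)
  finally show ?thesis unfolding H_def .
qed

lemma sum_order_eigenvalues:
  fixes e :: "nat \<Rightarrow> real"
  assumes H: "H \<in> carrier_mat n n" and cp: "char_poly H = (\<Prod>a<n. [:- complex_of_real (e a), 1:])"
  shows "(\<Sum>z | eigenvalue H z \<and> Q z. Polynomial.order z (char_poly H)) = card {a. a < n \<and> Q (of_real (e a))}"
proof -
  let ?K = "{a. a < n \<and> Q (of_real (e a))}"
  have "eigenvalue H z \<longleftrightarrow> (\<exists>a<n. z = of_real (e a))" for z
    unfolding eigenvalue_root_char_poly[OF H] cp by (auto simp: poly_prod)
  then have "{z. eigenvalue H z \<and> Q z} = (\<lambda>a. complex_of_real (e a)) ` ?K" by auto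
  moreover have "Polynomial.order z (char_poly H) = card {a \<in> ?K. complex_of_real (e a) = z}" if "Q z" for z
    unfolding cp order_prod_linear_factors[OF finite_lessThan]
    using that by (intro arg_cong[of _ _ card]) auto
  ultimately have "(\<Sum>z | eigenvalue H z \<and> Q z. Polynomial.order z (char_poly H))
    = (\<Sum>z\<in>(\<lambda>a. complex_of_real (e a)) ` ?K. \<Sum>a | a \<in> ?K \<and> complex_of_real (e a) = z. 1)"
    by (intro sum.cong) auto
  also have "\<dots> = (\<Sum>a\<in>?K. 1)" by (rule sum.image_gen[symmetric]) simp
  finally show ?thesis by simp
qed

section \<open>Sylvester's law of inertia\<close>

text \<open>The dimension count behind Sylvester's law of inertia. Suppose that more eigenvectors have a
  nonnegative eigenvalue than there are positive weights. Then some nontrivial combination \<open>v\<close> of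
  these eigenvectors is annihilated by every linear form of positive weight. The quadratic form is
  nonnegative at \<open>v\<close> by the eigenvector expansion and nonpositive by the expansion into weighted
  squares; so all the linear forms vanish at \<open>v\<close>, against their joint injectivity. Counting the
  zero eigenvalues together with the positive ones is what later excludes them.\<close>
lemma card_nonneg_eigenvalues_le:
  fixes \<delta> :: "'d \<Rightarrow> real" and B :: "'d \<Rightarrow> nat \<Rightarrow> real" and e :: "nat \<Rightarrow> real"
  assumes D: "finite D" and \<delta>: "\<And>d. d \<in> D \<Longrightarrow> \<delta> d \<noteq> 0"
    and inj: "\<And>v :: nat \<Rightarrow> complex. (\<And>d. d \<in> D \<Longrightarrow> (\<Sum>i<n. of_real (B d i) * v i) = 0)
      \<Longrightarrow> (\<And>i. i < n \<Longrightarrow> v i = 0)"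
    and eig: "\<And>a i. a < n \<Longrightarrow> i < n \<Longrightarrow>
      (\<Sum>j<n. of_real (\<Sum>d\<in>D. \<delta> d * B d i * B d j) * u a j) = of_real (e a) * u a i"
    and orth: "\<And>a b. a < n \<Longrightarrow> b < n \<Longrightarrow>
      (\<Sum>i<n. u a i * cnj (u b i)) = (if a = b then 1 else 0)"
  shows "card {a. a < n \<and> e a \<ge> 0} \<le> card {d \<in> D. \<delta> d > 0}"
proof (rule ccontr)
  let ?K = "{a. a < n \<and> e a \<ge> 0}" and ?E = "{d \<in> D. \<delta> d > 0}"
  assume "\<not> card ?K \<le> card ?E"
  then have "card ?E < card ?K" by simp
  from underdetermined_system_nontrivial_solution[OF _ _ this,
      of "\<lambda>d a. \<Sum>i<n. of_real (B d i) * u a i"] D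
  obtain c where c: "\<exists>a\<in>?K. c a \<noteq> 0"
    and c0: "\<And>d. d \<in> ?E \<Longrightarrow> (\<Sum>a\<in>?K. (\<Sum>i<n. of_real (B d i) * u a i) * c a) = 0" by auto
  define v where "v = (\<lambda>i. \<Sum>a\<in>?K. c a * u a i)"
  define L where "L = (\<lambda>d. \<Sum>i<n. of_real (B d i) * v i)"
  have L0: "L d = 0" if "d \<in> ?E" for d
  proof -
    have "L d = (\<Sum>i<n. \<Sum>a\<in>?K. of_real (B d i) * u a i * c a)"
      by (simp add: L_def v_def sum_distrib_left mult_ac)
    also have "\<dots> = (\<Sum>a\<in>?K. \<Sum>i<n. of_real (B d i) * u a i * c a)" by (rule sum.swap)
    also have "\<dots> = 0" using c0[OF that] by (simp add: sum_distrib_right)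
    finally show ?thesis .
  qed
  have coeff: "(\<Sum>i<n. u a i * cnj (v i)) = cnj (c a)" if "a \<in> ?K" for a
  proof -
    have "(\<Sum>i<n. u a i * cnj (v i)) = (\<Sum>i<n. \<Sum>b\<in>?K. cnj (c b) * (u a i * cnj (u b i)))"
      by (simp add: v_def sum_distrib_left mult_ac)
    also have "\<dots> = (\<Sum>b\<in>?K. \<Sum>i<n. cnj (c b) * (u a i * cnj (u b i)))" by (rule sum.swap)
    also have "\<dots> = (\<Sum>b\<in>?K. cnj (c b) * (if a = b then 1 else 0))"
      using that by (intro sum.cong refl) (simp add: orth flip: sum_distrib_left)
    also have "\<dots> = cnj (c a)" using that by (simp add: if_distrib cong: if_cong)
    finally show ?thesis .
  qed
  \<comment> \<open>The Hermitian form at \<open>v\<close>, computed below once by eigenvectors and once by squares.\<close>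
  let ?q = "\<Sum>i<n. (\<Sum>j<n. of_real (\<Sum>d\<in>D. \<delta> d * B d i * B d j) * v j) * cnj (v i)"
  have hv: "(\<Sum>j<n. of_real (\<Sum>d\<in>D. \<delta> d * B d i * B d j) * v j)
      = (\<Sum>a\<in>?K. c a * of_real (e a) * u a i)" if "i < n" for i
  proof -
    have "(\<Sum>j<n. of_real (\<Sum>d\<in>D. \<delta> d * B d i * B d j) * v j)
      = (\<Sum>j<n. \<Sum>a\<in>?K. c a * (of_real (\<Sum>d\<in>D. \<delta> d * B d i * B d j) * u a j))"
      by (simp add: v_def sum_distrib_left mult_ac del: of_real_sum)
    also have "\<dots> = (\<Sum>a\<in>?K. \<Sum>j<n. c a * (of_real (\<Sum>d\<in>D. \<delta> d * B d i * B d j) * u a j))"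
      by (rule sum.swap)
    also have "\<dots> = (\<Sum>a\<in>?K. c a * of_real (e a) * u a i)"
    proof (rule sum.cong[OF refl])
      fix a assume "a \<in> ?K"
      then have "a < n" by simp
      then show "(\<Sum>j<n. c a * (of_real (\<Sum>d\<in>D. \<delta> d * B d i * B d j) * u a j))
          = c a * of_real (e a) * u a i"
        unfolding sum_distrib_left[symmetric] eig[OF \<open>a < n\<close> that] by simp
    qed
    finally show ?thesis .
  qed
  have "?q = (\<Sum>i<n. \<Sum>a\<in>?K. c a * of_real (e a) * (u a i * cnj (v i)))"
  proof (rule sum.cong[OF refl])
    fix i assume "i \<in> {..<n}"
    then have "i < n" by simp
    show "(\<Sum>j<n. of_real (\<Sum>d\<in>D. \<delta> d * B d i * B d j) * v j) * cnj (v i)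
        = (\<Sum>a\<in>?K. c a * of_real (e a) * (u a i * cnj (v i)))"
      unfolding hv[OF \<open>i < n\<close>] sum_distrib_right by (simp add: mult.assoc)
  qed
  also have "\<dots> = (\<Sum>a\<in>?K. \<Sum>i<n. c a * of_real (e a) * (u a i * cnj (v i)))" by (rule sum.swap)
  also have "\<dots> = (\<Sum>a\<in>?K. of_real (e a * (cmod (c a))\<^sup>2))"
  proof (rule sum.cong[OF refl])
    fix a assume a: "a \<in> ?K"
    show "(\<Sum>i<n. c a * of_real (e a) * (u a i * cnj (v i))) = of_real (e a * (cmod (c a))\<^sup>2)"
      unfolding sum_distrib_left[symmetric] coeff[OF a] of_real_mult complex_norm_square
      by (simp only: mult_ac)
  qed
  finally have q1: "?q = of_real (\<Sum>a\<in>?K. e a * (cmod (c a))\<^sup>2)" by simp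
  have "?q = (\<Sum>i<n. \<Sum>j<n. \<Sum>d\<in>D. of_real (\<delta> d) * ((of_real (B d j) * v j) * cnj (of_real (B d i) * v i)))"
    by (simp add: sum_distrib_right sum_distrib_left mult_ac)
  also have "\<dots> = (\<Sum>i<n. \<Sum>d\<in>D. \<Sum>j<n. of_real (\<delta> d) * ((of_real (B d j) * v j) * cnj (of_real (B d i) * v i)))"
    by (intro sum.cong refl sum.swap)
  also have "\<dots> = (\<Sum>d\<in>D. \<Sum>i<n. \<Sum>j<n. of_real (\<delta> d) * ((of_real (B d j) * v j) * cnj (of_real (B d i) * v i)))"
    by (rule sum.swap)
  also have "\<dots> = (\<Sum>d\<in>D. of_real (\<delta> d) * (L d * cnj (L d)))"
  proof (rule sum.cong[OF refl])
    fix d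
    have "L d * cnj (L d) = (\<Sum>j<n. \<Sum>i<n. (of_real (B d j) * v j) * cnj (of_real (B d i) * v i))"
      by (simp add: L_def sum_product)
    also have "\<dots> = (\<Sum>i<n. \<Sum>j<n. (of_real (B d j) * v j) * cnj (of_real (B d i) * v i))"
      by (rule sum.swap)
    finally show "(\<Sum>i<n. \<Sum>j<n. of_real (\<delta> d) * ((of_real (B d j) * v j) * cnj (of_real (B d i) * v i)))
        = of_real (\<delta> d) * (L d * cnj (L d))"
      by (simp add: sum_distrib_left)
  qed
  also have "\<dots> = of_real (\<Sum>d\<in>D. \<delta> d * (cmod (L d))\<^sup>2)"
    unfolding of_real_sum of_real_mult complex_norm_square ..
  finally have "(\<Sum>d\<in>D. \<delta> d * (cmod (L d))\<^sup>2) = (\<Sum>a\<in>?K. e a * (cmod (c a))\<^sup>2)"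
    unfolding q1 of_real_eq_iff by simp
  also have "\<dots> \<ge> 0" by (intro sum_nonneg) auto
  finally have nonneg: "(\<Sum>d\<in>D. \<delta> d * (cmod (L d))\<^sup>2) \<ge> 0" .
  have le0: "\<delta> d * (cmod (L d))\<^sup>2 \<le> 0" if "d \<in> D" for d
    using L0[of d] that by (cases "\<delta> d > 0") (auto intro: mult_nonpos_nonneg)
  have "(\<Sum>d\<in>D. - (\<delta> d * (cmod (L d))\<^sup>2)) = 0"
    using nonneg sum_nonneg[of D "\<lambda>d. - (\<delta> d * (cmod (L d))\<^sup>2)"] le0
    by (intro antisym) (auto simp: sum_negf)
  then have zero: "\<forall>d\<in>D. - (\<delta> d * (cmod (L d))\<^sup>2) = 0"
    by (subst (asm) sum_nonneg_eq_0_iff[OF D]) (use le0 in auto)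
  have "(\<Sum>i<n. of_real (B d i) * v i) = 0" if "d \<in> D" for d
  proof -
    have "\<delta> d * (cmod (L d))\<^sup>2 = 0" using zero that by auto
    then show ?thesis using \<delta>[OF that] by (simp add: L_def)
  qed
  then have "v i = 0" if "i < n" for i using that by (rule inj)
  then have "c a = 0" if "a \<in> ?K" for a using coeff[OF that] by simp
  then show False using c by blast
qed

text \<open>The bounds for both signs come from the same count, applied to the form and to its negative.
  When the index set \<open>D\<close> has exactly \<open>n\<close> elements, or when all the weights have one sign, the
  three conclusions together determine the inertia.\<close>
lemma inertia_of_signed_sum_of_squares:
  fixes \<delta> :: "'d \<Rightarrow> real" and B :: "'d \<Rightarrow> nat \<Rightarrow> real" and D :: "'d set" and n :: nat
  defines "H \<equiv> Matrix.mat n n (\<lambda>(i, j). complex_of_real (\<Sum>d\<in>D. \<delta> d * B d i * B d j))"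
  assumes D: "finite D" and \<delta>: "\<And>d. d \<in> D \<Longrightarrow> \<delta> d \<noteq> 0"
    and inj: "\<And>v :: nat \<Rightarrow> complex. (\<And>d. d \<in> D \<Longrightarrow> (\<Sum>i<n. of_real (B d i) * v i) = 0)
      \<Longrightarrow> (\<And>i. i < n \<Longrightarrow> v i = 0)"
  shows "i_plus H + i_zero H \<le> card {d \<in> D. \<delta> d > 0}"
    and "i_minus H + i_zero H \<le> card {d \<in> D. \<delta> d < 0}"
    and "i_plus H + i_minus H + i_zero H = n"
proof -
  let ?h = "\<lambda>i j. complex_of_real (\<Sum>d\<in>D. \<delta> d * B d i * B d j)"
  have "?h j i = cnj (?h i j)" for i j by (simp add: mult_ac)
  from hermitian_orthonormal_eigenvectors[of n ?h n, OF this order_refl]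
  obtain u :: "nat \<Rightarrow> nat \<Rightarrow> complex" and e :: "nat \<Rightarrow> real" where
    eig: "\<And>a i. a < n \<Longrightarrow> i < n \<Longrightarrow> (\<Sum>j<n. ?h i j * u a j) = of_real (e a) * u a i"
    and orth: "\<And>a b. a < n \<Longrightarrow> b < n \<Longrightarrow>
      (\<Sum>i<n. u a i * cnj (u b i)) = (if a = b then 1 else 0)"
    by blast
  have H: "H \<in> carrier_mat n n" by (simp add: H_def)
  have cp: "char_poly H = (\<Prod>a<n. [:- of_real (e a), 1:])"
    unfolding H_def using eig orth by (rule char_poly_of_orthonormal_eigenbasis)
  have ip: "i_plus H = card {a. a < n \<and> e a > 0}"
    and im: "i_minus H = card {a. a < n \<and> e a < 0}"
    and iz: "i_zero H = card {a. a < n \<and> e a = 0}"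
    unfolding i_plus_def i_minus_def i_zero_def
    using sum_order_eigenvalues[OF H cp, of "\<lambda>z. z \<in> \<real> \<and> Re z > 0"]
      sum_order_eigenvalues[OF H cp, of "\<lambda>z. z \<in> \<real> \<and> Re z < 0"]
      sum_order_eigenvalues[OF H cp, of "\<lambda>z. z = 0"] by simp_all
  have ge: "i_plus H + i_zero H = card {a. a < n \<and> e a \<ge> 0}"
    unfolding ip iz by (subst card_Un_disjoint[symmetric]) (auto intro!: arg_cong[of _ _ card])
  have le: "i_minus H + i_zero H = card {a. a < n \<and> - e a \<ge> 0}"
    unfolding im iz by (subst card_Un_disjoint[symmetric]) (auto intro!: arg_cong[of _ _ card])
  show "i_plus H + i_zero H \<le> card {d \<in> D. \<delta> d > 0}"
    unfolding ge using D \<delta> inj eig orth by (rule card_nonneg_eigenvalues_le)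
  have eig': "(\<Sum>j<n. of_real (\<Sum>d\<in>D. - \<delta> d * B d i * B d j) * u a j) = of_real (- e a) * u a i"
    if "a < n" "i < n" for a i
    using eig[OF that] by (simp add: sum_negf)
  have "card {a. a < n \<and> - e a \<ge> 0} \<le> card {d \<in> D. - \<delta> d > 0}"
    by (rule card_nonneg_eigenvalues_le[where \<delta> = "\<lambda>d. - \<delta> d" and e = "\<lambda>a. - e a"
          and u = u and B = B])
      (use D \<delta> inj eig' orth in \<open>auto simp del: of_real_sum\<close>)
  then show "i_minus H + i_zero H \<le> card {d \<in> D. \<delta> d < 0}" unfolding le by simp
  have "i_plus H + i_minus H + i_zero H = card {a. a < n \<and> e a \<ge> 0} + card {a. a < n \<and> e a < 0}"
    using ge im by simp
  also have "\<dots> = card ({a. a < n \<and> e a \<ge> 0} \<union> {a. a < n \<and> e a < 0})"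
    by (rule card_Un_disjoint[symmetric]) auto
  also have "{a. a < n \<and> e a \<ge> 0} \<union> {a. a < n \<and> e a < 0} = {..<n}" by auto
  finally show "i_plus H + i_minus H + i_zero H = n" by simp
qed

section \<open>Unitary divisors\<close>

text \<open>Unitary divisors are those in which each prime occurs either not at all or to its full power;
  this turns every question on unitary divisors into one on exponents.\<close>
lemma udvd_iff_multiplicity:
  assumes "n > 0"
  shows "d udvd n \<longleftrightarrow>
    d > 0 \<and> (\<forall>p. prime p \<longrightarrow> multiplicity p d = 0 \<or> multiplicity p d = multiplicity p n)"
proof
  assume ud: "d udvd n"
  then obtain e where n: "n = d * e" by (auto simp: unitary_divisor_def)
  have pos: "d > 0" "e > 0" using assms n by auto
  then have cop: "coprime d e" using ud n by (simp add: unitary_divisor_def)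
  have "multiplicity p d = 0 \<or> multiplicity p d = multiplicity p n" if p: "prime p" for p
  proof -
    have "\<not> (p dvd d \<and> p dvd e)" using coprime_common_divisor[OF cop, of p] p by auto
    then have "multiplicity p d = 0 \<or> multiplicity p e = 0"
      by (auto dest: not_dvd_imp_multiplicity_0)
    moreover have "multiplicity p n = multiplicity p d + multiplicity p e"
      using p pos unfolding n by (intro prime_elem_multiplicity_mult_distrib) auto
    ultimately show ?thesis by auto
  qed
  then show "d > 0 \<and> (\<forall>p. prime p \<longrightarrow> multiplicity p d = 0 \<or> multiplicity p d = multiplicity p n)"
    using pos by blast
next
  assume *: "d > 0 \<and> (\<forall>p. prime p \<longrightarrow> multiplicity p d = 0 \<or> multiplicity p d = multiplicity p n)"
  have "d dvd n"
  proof (rule multiplicity_le_imp_dvd)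
    fix p :: nat assume "prime p"
    then have "multiplicity p d = 0 \<or> multiplicity p d = multiplicity p n" using * by blast
    then show "multiplicity p d \<le> multiplicity p n" by auto
  qed (use * in simp)
  then obtain e where n: "n = d * e" by auto
  have pos: "d > 0" "e > 0" using assms n by auto
  have "coprime d e"
  proof (rule ccontr)
    assume "\<not> coprime d e"
    then obtain c where c: "c dvd d" "c dvd e" "c \<noteq> 1" by (auto elim: not_coprimeE)
    then obtain p where "prime p" "p dvd c" using prime_factor_nat by blast
    then have p: "prime p" "p dvd d" "p dvd e" using c by (auto intro: dvd_trans)
    have "multiplicity p n = multiplicity p d + multiplicity p e"
      using p pos unfolding n by (intro prime_elem_multiplicity_mult_distrib) auto
    moreover have "multiplicity p d > 0" "multiplicity p e > 0"
      using p pos by (auto simp: prime_multiplicity_gt_zero_iff)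
    moreover have "multiplicity p d = 0 \<or> multiplicity p d = multiplicity p n"
      using * p(1) by blast
    ultimately show False by simp
  qed
  then show "d udvd n" using n pos by (simp add: unitary_divisor_def)
qed

lemma udvd_imp_le: "d udvd n \<Longrightarrow> n > 0 \<Longrightarrow> d \<le> n"
  unfolding unitary_divisor_def by (auto intro: dvd_imp_le)

lemma udvd_refl: "n > 0 \<Longrightarrow> n udvd n"
  unfolding unitary_divisor_def by simp

lemma finite_unitary_divisors: "n > 0 \<Longrightarrow> finite {d. d udvd n}"
  by (rule finite_subset[of _ "{..n}"]) (auto dest: udvd_imp_le)

text \<open>The common unitary divisors are governed by the primes that have the same exponent in \<open>a\<close> and
  \<open>b\<close>. The product \<open>g\<close> of the corresponding prime powers is itself a common unitary divisor of which
  all the others are unitary divisors, so it is the greatest one.\<close>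
lemma common_unitary_divisors_eq:
  assumes a: "a > 0" and b: "b > 0"
  shows "{d. d udvd a \<and> d udvd b} = {d. d udvd gcud a b}" and "gcud a b > 0"
proof -
  define T where "T = {p \<in> prime_factors a. multiplicity p a = multiplicity p b}"
  define g where "g = (\<Prod>p\<in>T. p ^ multiplicity p a)"
  have T: "finite T" "\<And>p. p \<in> T \<Longrightarrow> prime p" by (auto simp: T_def)
  have g0: "g > 0" unfolding g_def using T by (intro prod_pos) (auto intro: prime_gt_0_nat)
  have mg: "multiplicity p g = (if multiplicity p a = multiplicity p b then multiplicity p a else 0)"
    if "prime p" for p
    unfolding g_def using multiplicity_prod_prime_powers[OF T that] that
    by (auto simp: T_def prime_factors_multiplicity)
  have "d udvd a \<and> d udvd b \<longleftrightarrow> d udvd g" for d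
    unfolding udvd_iff_multiplicity[OF a] udvd_iff_multiplicity[OF b] udvd_iff_multiplicity[OF g0]
    by (auto simp: mg split: if_splits) (metis mg)+
  then have eq: "{d. d udvd a \<and> d udvd b} = {d. d udvd g}" by blast
  have "gcud a b = g"
    unfolding gcud_def eq using finite_unitary_divisors[OF g0] udvd_refl[OF g0] g0
    by (intro Max_eqI) (auto dest: udvd_imp_le)
  then show "{d. d udvd a \<and> d udvd b} = {d. d udvd gcud a b}" "gcud a b > 0" using eq g0 by auto
qed

lemma gcud_dvd:
  assumes "a > 0" "b > 0"
  shows "gcud a b dvd a"
proof -
  have "gcud a b \<in> {d. d udvd gcud a b}"
    using udvd_refl common_unitary_divisors_eq(2)[OF assms] by blast
  then have "gcud a b udvd a" unfolding common_unitary_divisors_eq(1)[OF assms, symmetric] by blast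
  then show ?thesis unfolding unitary_divisor_def by blast
qed

lemma real_pseudo_lcum:
  assumes "a > 0" "b > 0"
  shows "real (pseudo_lcum a b) = real a * real b / real (gcud a b)"
  unfolding pseudo_lcum_def using dvd_mult2[OF gcud_dvd[OF assms], of b]
  by (subst real_of_nat_div) (assumption, simp)

text \<open>The unitary analogue of Jordan's totient function: the unitary convolution of \<open>n powr s\<close> with
  the unitary Moebius function.\<close>
definition unitary_jordan :: "real \<Rightarrow> nat \<Rightarrow> real" where
  "unitary_jordan s n = (\<Prod>p\<in>prime_factors n. real (p ^ multiplicity p n) powr s - 1)"

text \<open>A unitary divisor is the choice of a subset of the prime factors.\<close>
lemma prime_factors_of_unitary_divisors:
  assumes n: "n > 0"
  shows "bij_betw prime_factors {d. d udvd n} (Pow (prime_factors n))"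
proof (rule bij_betw_byWitness[where f' = "\<lambda>T. \<Prod>p\<in>T. p ^ multiplicity p n"])
  show "\<forall>d\<in>{d. d udvd n}. (\<Prod>p\<in>prime_factors d. p ^ multiplicity p n) = d"
  proof safe
    fix d assume d: "d udvd n"
    note d' = d[unfolded udvd_iff_multiplicity[OF n]]
    have "(\<Prod>p\<in>prime_factors d. p ^ multiplicity p n) = (\<Prod>p\<in>prime_factors d. p ^ multiplicity p d)"
      using d' by (intro prod.cong refl) (auto simp: prime_factors_multiplicity)
    then show "(\<Prod>p\<in>prime_factors d. p ^ multiplicity p n) = d"
      using prime_factorization_nat d' by auto
  qed
  have mult: "multiplicity q (\<Prod>p\<in>T. p ^ multiplicity p n) = (if q \<in> T then multiplicity q n else 0)"
    if "T \<subseteq> prime_factors n" "prime q" for T q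
    using that by (intro multiplicity_prod_prime_powers) (auto intro: finite_subset)
  show "\<forall>T\<in>Pow (prime_factors n). prime_factors (\<Prod>p\<in>T. p ^ multiplicity p n) = T"
  proof safe
    fix T q assume "T \<subseteq> prime_factors n" "q \<in> prime_factors (\<Prod>p\<in>T. p ^ multiplicity p n)"
    then show "q \<in> T" using mult[of T q] by (auto simp: prime_factors_multiplicity split: if_splits)
  next
    fix T q assume "T \<subseteq> prime_factors n" "q \<in> T"
    then show "q \<in> prime_factors (\<Prod>p\<in>T. p ^ multiplicity p n)"
      using mult[of T q] by (auto simp: prime_factors_multiplicity)
  qed
  show "prime_factors ` {d. d udvd n} \<subseteq> Pow (prime_factors n)"
    using n by (auto simp: unitary_divisor_def intro: dvd_prime_factors[THEN subsetD])
  show "(\<lambda>T. \<Prod>p\<in>T. p ^ multiplicity p n) ` Pow (prime_factors n) \<subseteq> {d. d udvd n}"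
  proof safe
    fix T assume T: "T \<subseteq> prime_factors n"
    have "(\<Prod>p\<in>T. p ^ multiplicity p n) > 0"
      using T by (intro prod_pos) (auto intro!: prime_gt_0_nat)
    then show "(\<Prod>p\<in>T. p ^ multiplicity p n) udvd n"
      using mult[OF T] by (auto simp: udvd_iff_multiplicity[OF n])
  qed
qed

text \<open>Write \<open>q\<close> for the \<open>s\<close>-th power of a prime-power component of \<open>n\<close>. Expanding the product of the
  terms \<open>(q - 1) + 1\<close> gives one summand for each subset of the prime factors, that is, for each
  unitary divisor.\<close>
lemma powr_eq_sum_unitary_jordan:
  assumes n: "n > 0"
  shows "real n powr s = (\<Sum>d | d udvd n. unitary_jordan s d)"
proof -
  let ?F = "\<lambda>p. real (p ^ multiplicity p n) powr s - 1"
  have "real n powr s = (\<Prod>p\<in>prime_factors n. real (p ^ multiplicity p n)) powr s"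
    using prime_factorization_nat[OF n] by (metis of_nat_prod)
  also have "\<dots> = (\<Prod>p\<in>prime_factors n. ?F p + 1)"
    by (subst prod_powr_distrib) auto
  also have "\<dots> = (\<Sum>T\<in>Pow (prime_factors n). \<Prod>p\<in>T. ?F p)"
    by (subst prod_add) auto
  also have "\<dots> = (\<Sum>d | d udvd n. \<Prod>p\<in>prime_factors d. ?F p)"
    using prime_factors_of_unitary_divisors[OF n] by (rule sum.reindex_bij_betw[symmetric])
  also have "\<dots> = (\<Sum>d | d udvd n. unitary_jordan s d)"
    unfolding unitary_jordan_def
    by (intro sum.cong prod.cong refl)
       (auto simp: udvd_iff_multiplicity[OF n] prime_factors_multiplicity)
  finally show ?thesis .
qed

lemma prime_power_factor_gt_1:
  assumes "p \<in> prime_factors n"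
  shows "real (p ^ multiplicity p n) > 1"
proof -
  have "p > 1" "multiplicity p n > 0"
    using assms prime_gt_1_nat[of p] by (auto simp: prime_factors_multiplicity)
  then have "p ^ multiplicity p n > 1" by (rule one_less_power)
  then show ?thesis by (simp del: of_nat_power)
qed

lemma unitary_jordan_pos: "s > 0 \<Longrightarrow> unitary_jordan s n > 0"
  unfolding unitary_jordan_def using prime_power_factor_gt_1 by (intro prod_pos) (simp del: of_nat_power)

text \<open>For a negative exponent each of the \<open>omega n\<close> factors is negative. This is where the parity of
  \<open>omega\<close> enters.\<close>
lemma unitary_jordan_sign:
  assumes "s < 0"
  shows "\<exists>c>0. unitary_jordan s n = (-1) ^ omega n * c"
proof -
  let ?G = "\<lambda>p. 1 - real (p ^ multiplicity p n) powr s"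
  have "unitary_jordan s n = (\<Prod>p\<in>prime_factors n. - 1 * ?G p)"
    by (simp add: unitary_jordan_def)
  also have "\<dots> = (-1) ^ omega n * (\<Prod>p\<in>prime_factors n. ?G p)"
    unfolding prod.distrib by (simp add: omega_def)
  finally have "unitary_jordan s n = (-1) ^ omega n * (\<Prod>p\<in>prime_factors n. ?G p)" .
  moreover have "(\<Prod>p\<in>prime_factors n. ?G p) > 0"
    using prime_power_factor_gt_1 assms by (intro prod_pos) (simp add: powr_less_one del: of_nat_power)
  ultimately show ?thesis by blast
qed

text \<open>The incidence matrix of unitary divisibility is triangular for the usual order: at an index \<open>k\<close>
  with \<open>v k \<noteq> 0\<close> and \<open>x k\<close> as large as possible, the equation for the divisor \<open>x k\<close> reduces to the
  single term \<open>w k * v k\<close>.\<close>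
lemma unitary_incidence_injective:
  fixes x :: "nat \<Rightarrow> nat" and v :: "nat \<Rightarrow> complex"
  assumes inj: "inj_on x {..<n}" and pos: "\<And>i. i < n \<Longrightarrow> x i > 0"
    and w: "\<And>i. i < n \<Longrightarrow> w i \<noteq> 0"
    and zero: "\<And>k. k < n \<Longrightarrow>
      (\<Sum>i<n. complex_of_real (if x k udvd x i then w i else 0) * v i) = 0"
    and i: "i < n"
  shows "v i = 0"
proof (rule ccontr)
  assume "v i \<noteq> 0"
  let ?X = "x ` {j. j < n \<and> v j \<noteq> 0}"
  have "Max ?X \<in> ?X" using \<open>v i \<noteq> 0\<close> i by (intro Max_in) auto
  then obtain k where k: "k < n" "v k \<noteq> 0" and xk: "x k = Max ?X" by auto
  have max: "x j \<le> x k" if "j < n" "v j \<noteq> 0" for j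
    unfolding xk using that by (intro Max_ge) auto
  have "complex_of_real (if x k udvd x j then w j else 0) * v j = (if j = k then w k * v k else 0)"
    if j: "j < n" for j
  proof (cases "j = k")
    case True
    then show ?thesis using udvd_refl[OF pos[OF k(1)]] by simp
  next
    case False
    then have "x j \<noteq> x k" using inj j k(1) by (auto dest: inj_onD)
    then have "x k udvd x j \<Longrightarrow> v j = 0"
      using udvd_imp_le[of "x k" "x j"] pos[OF j] max[OF j] by force
    then show ?thesis using False by auto
  qed
  then have "(\<Sum>j<n. complex_of_real (if x k udvd x j then w j else 0) * v j) = w k * v k"
    using k(1) by simp
  then show False using zero[OF k(1)] w[OF k(1)] k(2) by simp
qed

section \<open>Inertia of the two matrices\<close>

text \<open>The factors \<open>w i\<close> do not affect the signs of the squares; they are there to absorb the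
  numerator \<open>x i powr m * x j powr m\<close> of the pseudo-LCUM.\<close>
lemma weighted_gcud_power_matrix_inertia:
  fixes x :: "nat \<Rightarrow> nat" and w :: "nat \<Rightarrow> real" and s :: real and S :: "nat set" and n :: nat
  defines "H \<equiv> Matrix.mat n n
      (\<lambda>(i, j). complex_of_real (w i * w j * real (gcud (x i) (x j)) powr s))"
    and "D \<equiv> {d. \<exists>t\<in>S. d udvd t}"
  assumes bij: "bij_betw x {..<n} S" and pos: "\<And>t. t \<in> S \<Longrightarrow> t > 0"
    and w: "\<And>i. i < n \<Longrightarrow> w i \<noteq> 0"
    and J: "\<And>d. d \<in> D \<Longrightarrow> unitary_jordan s d \<noteq> 0"
  shows "i_plus H + i_zero H \<le> card {d \<in> D. unitary_jordan s d > 0}"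
    and "i_minus H + i_zero H \<le> card {d \<in> D. unitary_jordan s d < 0}"
    and "i_plus H + i_minus H + i_zero H = n"
proof -
  define B where "B = (\<lambda>d i. if d udvd x i then w i else 0)"
  have xS: "x i \<in> S" if "i < n" for i using bij that by (auto simp: bij_betw_def)
  then have xpos: "x i > 0" if "i < n" for i using pos that by blast
  have "finite S" using bij bij_betw_finite by blast
  moreover have "D = (\<Union>t\<in>S. {d. d udvd t})" by (auto simp: D_def)
  ultimately have D: "finite D" using finite_unitary_divisors pos by simp
  have entry: "w i * w j * real (gcud (x i) (x j)) powr s
      = (\<Sum>d\<in>D. unitary_jordan s d * B d i * B d j)" if ij: "i < n" "j < n" for i j
  proof -
    have sub: "{d. d udvd x i \<and> d udvd x j} \<subseteq> D" using xS[OF ij(1)] by (auto simp: D_def)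
    have "real (gcud (x i) (x j)) powr s
        = (\<Sum>d | d udvd x i \<and> d udvd x j. unitary_jordan s d)"
      using common_unitary_divisors_eq[OF xpos[OF ij(1)] xpos[OF ij(2)]]
      by (simp add: powr_eq_sum_unitary_jordan)
    then have "w i * w j * real (gcud (x i) (x j)) powr s
        = (\<Sum>d | d udvd x i \<and> d udvd x j. unitary_jordan s d * B d i * B d j)"
      by (simp add: sum_distrib_left B_def mult_ac)
    also have "\<dots> = (\<Sum>d\<in>D. unitary_jordan s d * B d i * B d j)"
      by (rule sum.mono_neutral_left[OF D sub]) (auto simp: B_def)
    finally show ?thesis .
  qed
  have H: "H = Matrix.mat n n
      (\<lambda>(i, j). complex_of_real (\<Sum>d\<in>D. unitary_jordan s d * B d i * B d j))"
    unfolding H_def by (rule eq_matI) (simp_all add: entry del: of_real_sum of_real_mult)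
  have inj: "v i = 0"
    if zero: "\<And>d. d \<in> D \<Longrightarrow> (\<Sum>i<n. complex_of_real (B d i) * v i) = 0" and i: "i < n"
    for v :: "nat \<Rightarrow> complex" and i
  proof (rule unitary_incidence_injective[OF _ xpos w _ i])
    show "inj_on x {..<n}" using bij by (simp add: bij_betw_def)
  next
    fix k assume k: "k < n"
    have "x k \<in> D" using xS[OF k] udvd_refl[OF xpos[OF k]] by (auto simp: D_def)
    from zero[OF this]
    show "(\<Sum>i<n. complex_of_real (if x k udvd x i then w i else 0) * v i) = 0"
      by (simp add: B_def)
  qed
  show "i_plus H + i_zero H \<le> card {d \<in> D. unitary_jordan s d > 0}"
    unfolding H using D J inj by (rule inertia_of_signed_sum_of_squares(1))
  show "i_minus H + i_zero H \<le> card {d \<in> D. unitary_jordan s d < 0}"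
    unfolding H using D J inj by (rule inertia_of_signed_sum_of_squares(2))
  show "i_plus H + i_minus H + i_zero H = n"
    unfolding H using D J inj by (rule inertia_of_signed_sum_of_squares(3))
qed

theorem theorem4p3:
  fixes m :: real and f :: "real \<Rightarrow> real" and S :: "nat set" and n :: nat and x :: "nat \<Rightarrow> nat"
  assumes "m > 0"
    and "\<And>t. t > 0 \<Longrightarrow> f t = t powr m"
    and "bij_betw x {..<n} S"
    and "\<And>s. s \<in> S \<Longrightarrow> s > 0"
  shows "(i_plus (gcud_matrix f n x) = n \<and>
          i_minus (gcud_matrix f n x) = 0 \<and>
          i_zero (gcud_matrix f n x) = 0) \<and>
         (UD_closed S \<longrightarrow>
          i_plus (pseudo_lcum_matrix f n x) = card {s \<in> S. even (omega s)} \<and>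
          i_minus (pseudo_lcum_matrix f n x) = card {s \<in> S. odd (omega s)} \<and>
          i_zero (pseudo_lcum_matrix f n x) = 0)"
proof -
  note m = assms(1) and f = assms(2) and bij = assms(3) and pos = assms(4)
  have xpos: "x i > 0" if "i < n" for i using bij pos that by (auto simp: bij_betw_def)
  have gpos: "gcud (x i) (x j) > 0" if "i < n" "j < n" for i j
    using common_unitary_divisors_eq(2) xpos that by blast
  let ?D = "{d. \<exists>t\<in>S. d udvd t}"
  have "i_plus (gcud_matrix f n x) = n \<and> i_minus (gcud_matrix f n x) = 0
      \<and> i_zero (gcud_matrix f n x) = 0"
  proof -
    have G: "gcud_matrix f n x = Matrix.mat n n
        (\<lambda>(i, j). complex_of_real (1 * 1 * real (gcud (x i) (x j)) powr m))"
      unfolding gcud_matrix_def by (rule eq_matI) (simp_all add: f gpos)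
    have J: "unitary_jordan m d > 0" for d using m by (rule unitary_jordan_pos)
    have J0: "unitary_jordan m d \<noteq> 0" for d using J[of d] by simp
    note inertia = weighted_gcud_power_matrix_inertia[where w = "\<lambda>_. 1" and s = m,
        OF bij pos one_neq_zero J0, folded G]
    have no_negative: "{d \<in> ?D. unitary_jordan m d < 0} = {}" using J by (auto simp: not_less less_imp_le)
    have "i_minus (gcud_matrix f n x) + i_zero (gcud_matrix f n x) = 0"
      using inertia(2) unfolding no_negative by simp
    then show ?thesis using inertia(3) by simp
  qed
  moreover have "i_plus (pseudo_lcum_matrix f n x) = card {s \<in> S. even (omega s)} \<and>
      i_minus (pseudo_lcum_matrix f n x) = card {s \<in> S. odd (omega s)} \<and>
      i_zero (pseudo_lcum_matrix f n x) = 0" if closed: "UD_closed S"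
  proof -
    have entry: "f (real (pseudo_lcum (x i) (x j)))
        = real (x i) powr m * real (x j) powr m * real (gcud (x i) (x j)) powr (- m)"
      if ij: "i < n" "j < n" for i j
    proof -
      have "f (real (pseudo_lcum (x i) (x j)))
          = (real (x i) * real (x j) / real (gcud (x i) (x j))) powr m"
        using real_pseudo_lcum[OF xpos[OF ij(1)] xpos[OF ij(2)]] xpos ij gpos[OF ij]
        by (simp add: f)
      then show ?thesis by (simp add: powr_divide powr_mult powr_minus_divide)
    qed
    have P: "pseudo_lcum_matrix f n x = Matrix.mat n n
        (\<lambda>(i, j). complex_of_real
          (real (x i) powr m * real (x j) powr m * real (gcud (x i) (x j)) powr (- m)))"
      unfolding pseudo_lcum_matrix_def
      by (rule eq_matI) (simp_all add: entry del: of_real_mult)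
    have sign: "\<exists>c>0. unitary_jordan (- m) d = (-1) ^ omega d * c" for d
      using m by (intro unitary_jordan_sign) simp
    have Jpos: "unitary_jordan (- m) d > 0 \<longleftrightarrow> even (omega d)"
      and Jneg: "unitary_jordan (- m) d < 0 \<longleftrightarrow> odd (omega d)"
      and J0: "unitary_jordan (- m) d \<noteq> 0" for d
      using sign[of d] by (cases "even (omega d)"; auto)+
    have w: "real (x i) powr m \<noteq> 0" if "i < n" for i using xpos[OF that] by simp
    note inertia = weighted_gcud_power_matrix_inertia
      [where w = "\<lambda>i. real (x i) powr m" and s = "- m", OF bij pos w J0, folded P]
    \<comment> \<open>UD-closure makes the number of squares equal to the number of variables.\<close>
    have DS: "?D = S" using closed udvd_refl pos unfolding UD_closed_def by blast
    have fin: "finite S" using bij bij_betw_finite by blast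
    have "card {s \<in> S. even (omega s)} + card {s \<in> S. odd (omega s)}
        = card ({s \<in> S. even (omega s)} \<union> {s \<in> S. odd (omega s)})"
      using fin by (intro card_Un_disjoint[symmetric]) auto
    also have "{s \<in> S. even (omega s)} \<union> {s \<in> S. odd (omega s)} = S" by auto
    also have "card S = n" using bij_betw_same_card[OF bij] by simp
    finally have "card {s \<in> S. even (omega s)} + card {s \<in> S. odd (omega s)} = n" .
    then show ?thesis using inertia unfolding DS Jpos Jneg by linarith
  qed
  ultimately show ?thesis by blast
qed

end
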